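(* Consider any of the Mean-Thinning process, the Twinning process, or the $(1+\beta)$-process with any constant $\beta\in(0,1)$. Then there exists a constant $\kappa>0$ (different for each process, independent of $n$) such that for all sufficiently large $n$, $$\Pr\big[\mathrm{Gap}(\kappa n\log n)\ge\kappa\log n\big]\ge1-n^{-1},$$ where the round index $\kappa n\log n$ is rounded down to an integer.
   Context: All processes act on $n$ bins and start with the empty load vector $x^0=(0,\dots,0)$; $x^t$ is the load vector after $t$ rounds, $W^t=\sum_ix_i^t$ and $\mathrm{Gap}(t)=\max_{i\in[n]}x_i^t-W^t/n$. Mean-Thinning: in each round $t\ge0$ sample two bins $i_1,i_2$ independently and uniformly at random; allocate one ball to $i_1$ if $x_{i_1}^t<t/n$, otherwise one ball to $i_2$. Twinning: in each round $t\ge0$ sample one bin $i$ uniformly at random; allocate two balls to $i$ if $x_i^t<W^t/n$, and one ball to $i$ if $x_i^t\ge W^t/n$. $(1+\beta)$-process: in each round, with probability $\beta$ sample two bins independently and uniformly and allocate one ball to the less loaded of the two (ties in favour of the bin with higher index); otherwise allocate one ball to a single uniformly sampled bin. *)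

theory Defs
imports "HOL-Probability.Probability"
begin

text \<open>
  Bins are numbered \<open>1..n\<close>. A load vector maps each bin to its load; values outside
  \<open>{1..n}\<close> are irrelevant and stay \<open>0\<close>.
\<close>

type_synonym load = "nat \<Rightarrow> nat"

definition total_load :: "nat \<Rightarrow> load \<Rightarrow> nat" where
  "total_load n x = (\<Sum>i\<in>{1..n}. x i)"

definition gap :: "nat \<Rightarrow> load \<Rightarrow> real" where
  "gap n x = real (Max (x ` {1..n})) - real (total_load n x) / real n"

definition allocate :: "nat \<Rightarrow> nat \<Rightarrow> load \<Rightarrow> load" where
  "allocate k i x = x(i := x i + k)"

text \<open>Meaningful only for \<open>n > 0\<close>.\<close>

definition uniform_bin :: "nat \<Rightarrow> nat pmf" where
  "uniform_bin n = pmf_of_set {1..n}"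

text \<open>
  The law of the next load vector, given the number of bins \<open>n\<close>, the index \<open>t\<close>
  of the round (counted from \<open>0\<close>) and the current load vector.
\<close>

type_synonym step = "nat \<Rightarrow> nat \<Rightarrow> load \<Rightarrow> load pmf"

definition mean_thinning :: step where
  "mean_thinning n t x = do {
     i1 \<leftarrow> uniform_bin n;
     i2 \<leftarrow> uniform_bin n;
     return_pmf (allocate 1 (if real (x i1) < real t / real n then i1 else i2) x)
   }"

definition twinning :: step where
  "twinning n t x = do {
     i \<leftarrow> uniform_bin n;
     return_pmf (allocate (if real (x i) < real (total_load n x) / real n then 2 else 1) i x)
   }"

definition less_loaded :: "load \<Rightarrow> nat \<Rightarrow> nat \<Rightarrow> nat" where
  "less_loaded x i j =
     (if x i < x j then i else if x j < x i then j else max i j)"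

definition one_plus_beta :: "real \<Rightarrow> step" where
  "one_plus_beta \<beta> n t x = do {
     two_choice \<leftarrow> bernoulli_pmf \<beta>;
     if two_choice then do {
       i1 \<leftarrow> uniform_bin n;
       i2 \<leftarrow> uniform_bin n;
       return_pmf (allocate 1 (less_loaded x i1 i2) x)
     } else do {
       i \<leftarrow> uniform_bin n;
       return_pmf (allocate 1 i x)
     }
   }"

text \<open>The law of the load vector after \<open>t\<close> rounds, started with empty bins.\<close>

primrec load_pmf :: "step \<Rightarrow> nat \<Rightarrow> nat \<Rightarrow> load pmf" where
  "load_pmf S n 0 = return_pmf (\<lambda>_. 0)"
| "load_pmf S n (Suc t) = do { x \<leftarrow> load_pmf S n t; S n t x }"

end

theory Submission
  imports Defs "HOL-Real_Asymp.Real_Asymp"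
begin

text \<open>
  With \<open>T = \<kappa> n ln n\<close> and \<open>h = 3 \<kappa> ln n\<close> the average load is at most
  \<open>2 \<kappa> ln n\<close>, so a large gap only needs some bin to reach load \<open>h\<close>.

  In Twinning and in the \<open>(1+\<beta>)\<close>-process every bin gains a ball with probability at least
  \<open>u = \<alpha> / n\<close> in each round, whatever the past. The product over the bins of the probabilities
  that a binomial variable with parameters \<open>r\<close> and \<open>u\<close> fails to fill the bin up to \<open>h\<close>, where
  \<open>r\<close> rounds remain, is then a supermartingale, although the bins are not independent. Its
  initial value is at most \<open>1 / (2 n)\<close> for small \<open>\<kappa>\<close>.

  In Mean-Thinning this bound on the gain holds only given that the first sample is rejected, so
  the argument applies with the number of rejections as the clock, provided that there are at
  least \<open>T / 64\<close> of them. Fewer are unlikely while all loads stay below \<open>h\<close>: the potential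
  \<open>\<Sum>i. exp (min y\<^sub>i 1) - y\<^sub>i\<^sup>2 / 4\<close> of the centred loads \<open>y\<^sub>i\<close>, plus four times the number of
  rejections, drifts upwards by at least \<open>1 / 4\<close> per round with increments of size
  \<open>O(ln n)\<close>, yet the potential never exceeds \<open>3 n\<close>.
\<close>

section \<open>Binomial tail probabilities\<close>

text \<open>
  \<open>reach u r d\<close> is the probability that \<open>r\<close> independent trials of success probability \<open>u\<close> give
  at least \<open>d\<close> successes.
\<close>

fun reach :: "real \<Rightarrow> nat \<Rightarrow> nat \<Rightarrow> real" where
  "reach u r 0 = 1"
| "reach u 0 (Suc d) = 0"
| "reach u (Suc r) (Suc d) = (1 - u) * reach u r (Suc d) + u * reach u r d"

text \<open>Conditioning on the first trial. Truncated subtraction lets the same formula cover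
  \<open>d = 0\<close>, where every term is 1.\<close>

lemma reach_Suc: "reach u (Suc r) d = (1 - u) * reach u r d + u * reach u r (d - 1)"
  by (cases d) auto

lemma reach_nonneg:
  assumes "0 \<le> u" "u \<le> 1"
  shows "0 \<le> reach u r d"
  using assms by (induction u r d rule: reach.induct) auto

lemma reach_le_1:
  assumes "0 \<le> u" "u \<le> 1"
  shows "reach u r d \<le> 1"
  using assms
proof (induction u r d rule: reach.induct)
  case (3 u r d)
  then have "(1 - u) * reach u r (Suc d) + u * reach u r d \<le> (1 - u) * 1 + u * 1"
    by (intro add_mono mult_left_mono) auto
  then show ?case by simp
qed auto

lemma reach_Suc_le:
  assumes "0 \<le> u" "u \<le> 1"
  shows "reach u r (Suc d) \<le> reach u r d"
  using assms
proof (induction r arbitrary: d)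
  case 0
  then show ?case by (cases d) auto
next
  case (Suc r)
  show ?case
  proof (cases d)
    case 0
    then show ?thesis using reach_le_1[OF assms] by (metis reach.simps(1))
  next
    case (Suc e)
    then show ?thesis using Suc.IH[of d] Suc.IH[of e] assms
      by (auto intro!: add_mono mult_left_mono)
  qed
qed

lemma reach_antimono:
  assumes "0 \<le> u" "u \<le> 1" "d \<le> e"
  shows "reach u r e \<le> reach u r d"
  using assms(3) by (rule lift_Suc_antimono_le[of "reach u r", rotated])
    (rule reach_Suc_le[OF assms(1,2)])

lemma reach_le_Suc:
  assumes "0 \<le> u" "u \<le> 1"
  shows "reach u r d \<le> reach u (Suc r) d"
proof -
  have "u * reach u r d \<le> u * reach u r (d - 1)"
    using assms by (intro mult_left_mono reach_antimono) auto
  then show ?thesis unfolding reach_Suc by (simp add: algebra_simps)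
qed

lemma reach_mono_rounds:
  assumes "0 \<le> u" "u \<le> 1" "r \<le> s"
  shows "reach u r d \<le> reach u s d"
  using assms(3) by (rule lift_Suc_mono_le[of "\<lambda>r. reach u r d", rotated])
    (rule reach_le_Suc[OF assms(1,2)])

text \<open>The two blocks of trials are independent, and \<open>d\<close> successes in the first
  with \<open>e\<close> in the second make \<open>d + e\<close> in total.\<close>

lemma reach_add:
  assumes u: "0 \<le> u" "u \<le> 1"
  shows "reach u r d * reach u s e \<le> reach u (r + s) (d + e)"
proof (induction r arbitrary: d)
  case 0
  then show ?case using reach_nonneg[OF u] by (cases d) auto
next
  case (Suc r)
  show ?case
  proof (cases d)
    case 0
    then show ?thesis using reach_mono_rounds[OF u, of s "Suc r + s"] by simp
  next
    case (Suc d')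
    have "(1 - u) * (reach u r d * reach u s e) + u * (reach u r d' * reach u s e)
        \<le> (1 - u) * reach u (r + s) (d + e) + u * reach u (r + s) (d' + e)"
      using Suc.IH u by (intro add_mono mult_left_mono) auto
    then show ?thesis using Suc by (simp add: algebra_simps)
  qed
qed

lemma reach_one: "reach u b (Suc 0) = 1 - (1 - u) ^ b"
proof (induction b)
  case (Suc b)
  then show ?case by (simp only: reach.simps) (simp add: algebra_simps)
qed auto

text \<open>Cut the trials into \<open>d\<close> blocks of length \<open>b\<close> and ask for at
  least one success in each block.\<close>

lemma reach_lower:
  assumes u: "0 \<le> u" "u \<le> 1"
  shows "(1 - (1 - u) ^ b) ^ d \<le> reach u (d * b) d"
proof (induction d)
  case (Suc d)
  have "(1 - (1 - u) ^ b) ^ Suc d \<le> reach u b (Suc 0) * reach u (d * b) d"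
    using Suc reach_nonneg[OF u, of b "Suc 0"] by (auto simp: reach_one intro!: mult_left_mono)
  also have "\<dots> \<le> reach u (Suc d * b) (Suc d)"
    using reach_add[OF u, of b "Suc 0" "d * b" d] by simp
  finally show ?case .
qed auto

section \<open>Product supermartingale for the event that no bin fills up\<close>

text \<open>A bin that already has load \<open>h\<close> makes its factor vanish, because
  \<open>h - x i\<close> truncates to 0 and \<open>reach u r 0 = 1\<close>.\<close>

definition avoid :: "nat \<Rightarrow> real \<Rightarrow> nat \<Rightarrow> nat \<Rightarrow> load \<Rightarrow> real" where
  "avoid n u h r x = (\<Prod>i\<in>{1..n}. 1 - reach u r (h - x i))"

text \<open>A weighted Weierstrass product inequality. On the left at most one factor drops, as when
  a single ball is placed; on the right all factors drop independently. In the induction the new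
  factor multiplies the hypothesis, and its own loss is compared through
  \<open>Q \<le> P\<close>.\<close>

lemma prod_minus_le:
  fixes f d :: "'a \<Rightarrow> real"
  assumes "finite A" "0 \<le> u" "u \<le> 1" "\<And>i. i \<in> A \<Longrightarrow> 0 \<le> d i \<and> d i \<le> f i"
  shows "(\<Prod>i\<in>A. f i) - u * (\<Sum>i\<in>A. d i * (\<Prod>j\<in>A - {i}. f j)) \<le> (\<Prod>i\<in>A. f i - u * d i)"
  using assms(1,4)
proof (induction A)
  case (insert a A)
  define P S Q where "P = (\<Prod>i\<in>A. f i)" and "S = (\<Sum>i\<in>A. d i * (\<Prod>j\<in>A - {i}. f j))"
    and "Q = (\<Prod>i\<in>A. f i - u * d i)"
  have ud: "0 \<le> f i - u * d i" "0 \<le> u * d i" if "i \<in> insert a A" for i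
  proof -
    have "0 \<le> d i" "d i \<le> f i" using insert.prems that by auto
    moreover from this have "u * d i \<le> d i" using assms(3) mult_left_le_one_le[of "d i" u] assms(2) by auto
    ultimately show "0 \<le> f i - u * d i" "0 \<le> u * d i" using assms(2) by auto
  qed
  have IH: "P - u * S \<le> Q" unfolding P_def S_def Q_def using insert by auto
  have QP: "Q \<le> P" unfolding P_def Q_def by (rule prod_mono) (use ud in auto)
  have "(\<Sum>i\<in>A. d i * (\<Prod>j\<in>insert a A - {i}. f j)) = (\<Sum>i\<in>A. f a * (d i * (\<Prod>j\<in>A - {i}. f j)))"
  proof (rule sum.cong[OF refl])
    fix i assume "i \<in> A"
    then have "insert a A - {i} = insert a (A - {i})" using insert.hyps by auto
    then show "d i * (\<Prod>j\<in>insert a A - {i}. f j) = f a * (d i * (\<Prod>j\<in>A - {i}. f j))"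
      using insert.hyps by simp
  qed
  also have "\<dots> = f a * S" by (simp add: S_def sum_distrib_left)
  moreover have "insert a A - {a} = A" using insert.hyps by auto
  ultimately have sum: "(\<Sum>i\<in>insert a A. d i * (\<Prod>j\<in>insert a A - {i}. f j)) = d a * P + f a * S"
    using insert.hyps by (simp add: P_def)
  have "f a * P - u * (d a * P + f a * S) = (f a * (P - u * S)) - (u * d a) * P"
    by (simp add: algebra_simps)
  also have "\<dots> \<le> f a * Q - (u * d a) * Q"
  proof -
    have "f a * (P - u * S) \<le> f a * Q" using IH insert.prems[of a] by (intro mult_left_mono) auto
    moreover have "(u * d a) * Q \<le> (u * d a) * P" using QP ud by (intro mult_left_mono) auto
    ultimately have "f a * (P - u * S) - (u * d a) * P \<le> f a * Q - (u * d a) * Q" by linarith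
    then show ?thesis .
  qed
  finally show ?case using insert.hyps sum by (simp add: P_def Q_def algebra_simps)
qed auto

context
  fixes n :: nat and u :: real
  assumes u: "0 \<le> u" "u \<le> 1"
begin

lemma avoid_nonneg: "0 \<le> avoid n u h r x"
  unfolding avoid_def using reach_le_1[OF u] by (intro prod_nonneg) auto

lemma avoid_antimono:
  assumes "\<And>i. i \<in> {1..n} \<Longrightarrow> x i \<le> y i"
  shows "avoid n u h r y \<le> avoid n u h r x"
  unfolding avoid_def
proof (intro prod_mono conjI)
  fix i assume "i \<in> {1..n}"
  then have "h - y i \<le> h - x i" using assms by (intro diff_le_mono2) auto
  from reach_antimono[OF u this] show "1 - reach u r (h - y i) \<le> 1 - reach u r (h - x i)" by simp
qed (use reach_le_1[OF u] in auto)

lemma avoid_allocate_le: "avoid n u h r (allocate k i x) \<le> avoid n u h r x"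
  by (rule avoid_antimono) (auto simp: allocate_def)

lemma avoid_0:
  assumes "\<And>i. i \<in> {1..n} \<Longrightarrow> x i < h"
  shows "avoid n u h 0 x = 1"
proof -
  have "reach u 0 (h - x i) = 0" if "i \<in> {1..n}" for i
    using assms[OF that] by (cases "h - x i") auto
  then show ?thesis by (simp add: avoid_def)
qed

lemma avoid_init: "avoid n u h r (\<lambda>_. 0) \<le> exp (- (real n * reach u r h))"
proof -
  have "avoid n u h r (\<lambda>_. 0) = (1 - reach u r h) ^ n" by (simp add: avoid_def)
  also have "\<dots> \<le> exp (- reach u r h) ^ n"
    using reach_le_1[OF u, of r h] exp_ge_add_one_self[of "- reach u r h"] by (intro power_mono) auto
  finally show ?thesis by (simp add: exp_of_nat_mult[symmetric])
qed

text \<open>The left side is the mean of \<open>avoid\<close> when each bin receives the ball with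
  probability \<open>u\<close> and these events exclude each other. The right side, expanded by
  \<open>reach_Suc\<close>, gives every bin an independent trial. \<open>prod_minus_le\<close>
  compares the two, \<open>d j\<close> being the loss of factor \<open>j\<close> caused by a
  ball.\<close>

lemma avoid_step:
  "avoid n u h r x - u * (\<Sum>j\<in>{1..n}. avoid n u h r x - avoid n u h r (allocate 1 j x))
     \<le> avoid n u h (Suc r) x"
proof -
  define f where "f = (\<lambda>i. 1 - reach u r (h - x i))"
  define d where "d = (\<lambda>i. reach u r (h - x i - 1) - reach u r (h - x i))"
  have "avoid n u h r x - avoid n u h r (allocate 1 j x) = d j * (\<Prod>i\<in>{1..n} - {j}. f i)"
    if "j \<in> {1..n}" for j
  proof -
    have "avoid n u h r (allocate 1 j x) =
        (1 - reach u r (h - x j - 1)) * (\<Prod>i\<in>{1..n} - {j}. f i)"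
      unfolding avoid_def f_def using that
      by (subst prod.remove[of _ j]) (auto simp: allocate_def intro!: prod.cong)
    moreover have "avoid n u h r x = f j * (\<Prod>i\<in>{1..n} - {j}. f i)"
      unfolding avoid_def f_def using that by (subst prod.remove[of _ j]) auto
    ultimately show ?thesis by (simp add: f_def d_def algebra_simps)
  qed
  then have "avoid n u h r x - u * (\<Sum>j\<in>{1..n}. avoid n u h r x - avoid n u h r (allocate 1 j x))
     = (\<Prod>i\<in>{1..n}. f i) - u * (\<Sum>i\<in>{1..n}. d i * (\<Prod>j\<in>{1..n} - {i}. f j))"
    by (simp add: avoid_def f_def)
  also have "\<dots> \<le> (\<Prod>i\<in>{1..n}. f i - u * d i)"
    using u reach_le_1[OF u] reach_antimono[OF u]
    by (intro prod_minus_le) (auto simp: f_def d_def)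
  also have "\<dots> = avoid n u h (Suc r) x"
    unfolding avoid_def f_def d_def reach_Suc by (intro prod.cong) (auto simp: algebra_simps)
  finally show ?thesis .
qed

end

section \<open>Finite expectations and a supermartingale bound\<close>

lemma expectation_bind_finite:
  fixes f :: "'b \<Rightarrow> real"
  assumes "finite (set_pmf p)" "\<And>x. x \<in> set_pmf p \<Longrightarrow> finite (set_pmf (K x))"
  shows "measure_pmf.expectation (p \<bind> K) f
       = measure_pmf.expectation p (\<lambda>x. measure_pmf.expectation (K x) f)"
  using assms
  by (subst pmf_expectation_bind[of "set_pmf p"])
     (auto simp: integral_measure_pmf_real[of "set_pmf p"] mult.commute)

text \<open>Markov's inequality at time \<open>T\<close>, after the expectation has been carried
  back to time 0. Finite supports settle integrability, and drift is asked for only at reachable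
  states before \<open>T\<close>.\<close>

lemma supermartingale_prob_le:
  fixes P :: "nat \<Rightarrow> 'a pmf" and V :: "nat \<Rightarrow> 'a \<Rightarrow> real"
  assumes step: "\<And>t. P (Suc t) = P t \<bind> K t"
    and fin: "finite (set_pmf (P 0))" "\<And>t x. finite (set_pmf (K t x))"
    and nonneg: "\<And>x. 0 \<le> V T x"
    and drift: "\<And>t x. t < T \<Longrightarrow> x \<in> set_pmf (P t) \<Longrightarrow>
       measure_pmf.expectation (K t x) (V (Suc t)) \<le> V t x"
    and E: "\<And>x. x \<in> set_pmf (P T) \<Longrightarrow> x \<in> E \<Longrightarrow> 1 \<le> V T x"
  shows "measure_pmf.prob (P T) E \<le> measure_pmf.expectation (P 0) (V 0)"
proof -
  have finP: "finite (set_pmf (P t))" for t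
    by (induction t) (use fin in \<open>auto simp: step\<close>)
  have mono: "measure_pmf.expectation (P t) f \<le> measure_pmf.expectation (P t) g"
    if "\<And>x. x \<in> set_pmf (P t) \<Longrightarrow> f x \<le> g x" for t and f g :: "'a \<Rightarrow> real"
    using that finP by (intro integral_mono_AE) (auto simp: AE_measure_pmf_iff integrable_measure_pmf_finite)
  have "t \<le> T \<Longrightarrow> measure_pmf.expectation (P t) (V t) \<le> measure_pmf.expectation (P 0) (V 0)" for t
  proof (induction t)
    case (Suc t)
    have "measure_pmf.expectation (P (Suc t)) (V (Suc t)) =
        measure_pmf.expectation (P t) (\<lambda>x. measure_pmf.expectation (K t x) (V (Suc t)))"
      unfolding step using finP fin by (intro expectation_bind_finite) auto
    also have "\<dots> \<le> measure_pmf.expectation (P t) (V t)"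
      using Suc.prems by (intro mono drift) auto
    finally show ?case using Suc by simp
  qed auto
  moreover have "measure_pmf.prob (P T) E \<le> measure_pmf.expectation (P T) (V T)"
  proof -
    have "measure_pmf.prob (P T) E = measure_pmf.expectation (P T) (indicator E)" by simp
    also have "\<dots> \<le> measure_pmf.expectation (P T) (V T)"
      using nonneg E by (intro mono) (auto simp: indicator_def)
    finally show ?thesis .
  qed
  ultimately show ?thesis by force
qed

section \<open>One round of Twinning and of the (1+\<beta>)-process\<close>

lemma expectation_uniform_bin:
  assumes "n > 0"
  shows "measure_pmf.expectation (uniform_bin n) f = (\<Sum>i\<in>{1..n}. f i) / real n"
  unfolding uniform_bin_def using assms by (subst integral_pmf_of_set) auto

lemma set_uniform_bin: "n > 0 \<Longrightarrow> set_pmf (uniform_bin n) = {1..n}"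
  unfolding uniform_bin_def by (rule set_pmf_of_set) auto

text \<open>\<open>avoid_step\<close> read as a round that throws a ball into a uniform bin with
  probability \<alpha> and does nothing otherwise.\<close>

lemma avoid_average:
  assumes "n > 0" "0 \<le> \<alpha>" "\<alpha> \<le> 1"
  shows "(1 - \<alpha>) * avoid n (\<alpha> / real n) h r x
      + \<alpha> * ((\<Sum>j\<in>{1..n}. avoid n (\<alpha> / real n) h r (allocate 1 j x)) / real n)
    \<le> avoid n (\<alpha> / real n) h (Suc r) x"
proof -
  have "\<alpha> / real n \<le> 1" using assms by (simp add: divide_le_eq)
  from avoid_step[OF _ this, of n h r x] show ?thesis
    using assms by (simp add: sum_subtractf field_simps)
qed

lemma finite_set_twinning: "n > 0 \<Longrightarrow> finite (set_pmf (twinning n t x))"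
  unfolding twinning_def by (simp add: set_uniform_bin)

lemma finite_set_one_plus_beta: "n > 0 \<Longrightarrow> finite (set_pmf (one_plus_beta \<beta> n t x))"
  unfolding one_plus_beta_def by (auto simp: set_uniform_bin split: if_splits)

lemma expectation_twinning:
  assumes "n > 0"
  shows "measure_pmf.expectation (twinning n t x) f =
    (\<Sum>i\<in>{1..n}. f (allocate (if real (x i) < real (total_load n x) / real n then 2 else 1) i x)) / real n"
  unfolding twinning_def
  by (subst expectation_bind_finite)
     (use assms in \<open>simp_all add: expectation_uniform_bin set_uniform_bin\<close>)

lemma expectation_one_plus_beta:
  assumes "n > 0" "0 \<le> \<beta>" "\<beta> \<le> 1"
  shows "measure_pmf.expectation (one_plus_beta \<beta> n t x) f =
    \<beta> * ((\<Sum>i\<in>{1..n}. (\<Sum>j\<in>{1..n}. f (allocate 1 (less_loaded x i j) x)) / real n) / real n)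
    + (1 - \<beta>) * ((\<Sum>j\<in>{1..n}. f (allocate 1 j x)) / real n)"
proof -
  have one: "measure_pmf.expectation (uniform_bin n \<bind> (\<lambda>i. return_pmf (g i))) f
      = (\<Sum>i\<in>{1..n}. f (g i)) / real n" for g
    by (subst expectation_bind_finite)
       (use assms in \<open>simp_all add: expectation_uniform_bin set_uniform_bin\<close>)
  have two: "measure_pmf.expectation (uniform_bin n \<bind> (\<lambda>i. uniform_bin n \<bind> (\<lambda>j. return_pmf (g i j)))) f
      = (\<Sum>i\<in>{1..n}. (\<Sum>j\<in>{1..n}. f (g i j)) / real n) / real n" for g
    by (subst expectation_bind_finite)
       (use assms in \<open>simp_all add: expectation_uniform_bin set_uniform_bin one sum_divide_distrib[symmetric]\<close>)
  show ?thesis unfolding one_plus_beta_def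
    by (subst expectation_bind_finite)
       (use assms in \<open>auto simp: one two set_uniform_bin mult.commute split: if_splits\<close>)
qed

text \<open>A second ball can only lower \<open>avoid\<close>, so the round is compared with one
  uniformly thrown ball.\<close>

lemma avoid_twinning:
  assumes "n > 0"
  shows "measure_pmf.expectation (twinning n t x) (avoid n (1 / real n) h r)
    \<le> avoid n (1 / real n) h (Suc r) x"
proof -
  have u: "0 \<le> 1 / real n" "1 / real n \<le> 1" using assms by (auto simp: divide_le_eq)
  have "(\<Sum>i\<in>{1..n}. avoid n (1 / real n) h r
          (allocate (if real (x i) < real (total_load n x) / real n then 2 else 1) i x))
      \<le> (\<Sum>i\<in>{1..n}. avoid n (1 / real n) h r (allocate 1 i x))"
    by (intro sum_mono avoid_antimono[OF u]) (auto simp: allocate_def)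
  from divide_right_mono[OF this, of "real n"] show ?thesis
    using avoid_average[OF assms, of 1 h r x] assms
    unfolding expectation_twinning[OF assms] by simp
qed

text \<open>The two-choice branch cannot raise \<open>avoid\<close> and is counted as an idle round;
  the single-sample branch, of probability \<open>1 - \<beta>\<close>, supplies all the
  gain.\<close>

lemma avoid_one_plus_beta:
  assumes "n > 0" "0 \<le> \<beta>" "\<beta> \<le> 1"
  shows "measure_pmf.expectation (one_plus_beta \<beta> n t x) (avoid n ((1 - \<beta>) / real n) h r)
    \<le> avoid n ((1 - \<beta>) / real n) h (Suc r) x"
proof -
  let ?V = "avoid n ((1 - \<beta>) / real n) h r"
  have u: "0 \<le> (1 - \<beta>) / real n" "(1 - \<beta>) / real n \<le> 1"
    using assms by (auto simp: divide_le_eq)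
  have "(\<Sum>i\<in>{1..n}. (\<Sum>j\<in>{1..n}. ?V (allocate 1 (less_loaded x i j) x)) / real n) / real n
      \<le> (\<Sum>i\<in>{1..n}. (\<Sum>j\<in>{1..n}. ?V x) / real n) / real n"
    by (intro divide_right_mono sum_mono avoid_allocate_le[OF u]) auto
  also have "\<dots> = ?V x" using assms by simp
  finally have "\<beta> * ((\<Sum>i\<in>{1..n}. (\<Sum>j\<in>{1..n}. ?V (allocate 1 (less_loaded x i j) x)) / real n) / real n)
      \<le> \<beta> * ?V x" using assms by (intro mult_left_mono) auto
  then show ?thesis
    using avoid_average[of n "1 - \<beta>" h r x] assms
    by (simp add: expectation_one_plus_beta)
qed

text \<open>The supermartingale is \<open>avoid\<close> with the remaining rounds
  \<open>T - t\<close> as its parameter; at time \<open>T\<close> it equals 1 when no bin is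
  full.\<close>

lemma prob_max_less_le:
  assumes "n > 0" "0 \<le> u" "u \<le> 1"
    and fin: "\<And>t x. finite (set_pmf (S n t x))"
    and step: "\<And>t r x. measure_pmf.expectation (S n t x) (avoid n u h r) \<le> avoid n u h (Suc r) x"
  shows "measure_pmf.prob (load_pmf S n T) {x. \<forall>i\<in>{1..n}. x i < h} \<le> exp (- (real n * reach u T h))"
proof -
  have "measure_pmf.prob (load_pmf S n T) {x. \<forall>i\<in>{1..n}. x i < h}
      \<le> measure_pmf.expectation (load_pmf S n 0) (avoid n u h (T - 0))"
  proof (rule supermartingale_prob_le[where K = "S n" and V = "\<lambda>t. avoid n u h (T - t)"])
    fix t x assume "t < T"
    then have "T - t = Suc (T - Suc t)" by simp
    then show "measure_pmf.expectation (S n t x) (avoid n u h (T - Suc t)) \<le> avoid n u h (T - t) x"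
      using step by simp
  qed (use fin assms avoid_nonneg avoid_0 in auto)
  then show ?thesis using avoid_init[OF assms(2,3), of n h T] by simp
qed

section \<open>From a full bin to a large gap\<close>

lemma total_load_allocate:
  "i \<in> {1..n} \<Longrightarrow> total_load n (allocate k i x) = total_load n x + k"
  unfolding total_load_def allocate_def
  by (subst (1 2) sum.remove[of _ i]) (auto intro!: sum.cong)

text \<open>The factor 2 comes from Twinning, which may place two balls in one round.\<close>

lemma total_load_le:
  assumes "\<And>t x y. y \<in> set_pmf (S n t x) \<Longrightarrow> \<exists>i\<in>{1..n}. \<exists>k\<le>2. y = allocate k i x"
    and "x \<in> set_pmf (load_pmf S n t)"
  shows "total_load n x \<le> 2 * t"
  using assms(2)
proof (induction t arbitrary: x)
  case 0
  then show ?case by (simp add: total_load_def)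
next
  case (Suc t)
  then obtain y where y: "y \<in> set_pmf (load_pmf S n t)" "x \<in> set_pmf (S n t y)" by auto
  from assms(1)[OF y(2)] obtain i k where "i \<in> {1..n}" "k \<le> 2" "x = allocate k i y" by blast
  then show ?case using Suc.IH[OF y(1)] by (simp add: total_load_allocate)
qed

lemma set_twinning:
  assumes "n > 0" "y \<in> set_pmf (twinning n t x)"
  shows "\<exists>i\<in>{1..n}. \<exists>k\<le>2. y = allocate k i x"
proof -
  from assms obtain i where "i \<in> {1..n}"
    "y = allocate (if real (x i) < real (total_load n x) / real n then 2 else 1) i x"
    unfolding twinning_def by (auto simp: set_uniform_bin)
  then show ?thesis by (intro bexI[of _ i] exI[of _ "if real (x i) < real (total_load n x) / real n then 2 else 1"]) auto
qed

lemma set_one_plus_beta: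
  assumes "n > 0" "y \<in> set_pmf (one_plus_beta \<beta> n t x)"
  shows "\<exists>i\<in>{1..n}. \<exists>k\<le>2. y = allocate k i x"
proof -
  have "\<exists>i\<in>{1..n}. y = allocate 1 i x"
    using assms unfolding one_plus_beta_def
    by (auto simp: set_uniform_bin less_loaded_def max_def split: if_splits)
  then show ?thesis by (metis one_le_numeral)
qed

lemma gap_ge:
  assumes "n > 0" and load: "total_load n x \<le> 2 * nat \<lfloor>\<kappa> * real n * ln (real n)\<rfloor>"
    and "\<kappa> \<ge> 0" and "i \<in> {1..n}" "nat \<lceil>3 * \<kappa> * ln (real n)\<rceil> \<le> x i"
  shows "\<kappa> * ln (real n) \<le> gap n x"
proof -
  have pos: "0 \<le> \<kappa> * real n * ln (real n)" using assms by auto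
  have "real (total_load n x) \<le> 2 * (\<kappa> * real n * ln (real n))"
  proof -
    have "real (total_load n x) \<le> 2 * real (nat \<lfloor>\<kappa> * real n * ln (real n)\<rfloor>)"
      using load by (metis of_nat_le_iff of_nat_mult of_nat_numeral)
    also have "\<dots> \<le> 2 * (\<kappa> * real n * ln (real n))" using pos by auto
    finally show ?thesis .
  qed
  then have "real (total_load n x) / real n \<le> 2 * (\<kappa> * ln (real n))"
    using assms(1) by (simp add: field_simps)
  moreover have "3 * \<kappa> * ln (real n) \<le> real (x i)"
    using assms(5) by linarith
  moreover have "x i \<le> Max (x ` {1..n})" using assms(4) by (intro Max_ge) auto
  ultimately show ?thesis unfolding gap_def by linarith
qed

lemma prob_gap_ge:
  assumes n: "n > 0" and "\<kappa> \<ge> 0" and T: "T = nat \<lfloor>\<kappa> * real n * ln (real n)\<rfloor>"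
    and load: "\<And>x. x \<in> set_pmf (load_pmf S n T) \<Longrightarrow> total_load n x \<le> 2 * T"
    and prob: "measure_pmf.prob (load_pmf S n T) {x. \<forall>i\<in>{1..n}. x i < nat \<lceil>3 * \<kappa> * ln (real n)\<rceil>} \<le> 1 / real n"
  shows "1 - 1 / real n \<le> measure_pmf.prob (load_pmf S n T) {x. \<kappa> * ln (real n) \<le> gap n x}"
proof -
  let ?M = "load_pmf S n T"
  have "1 - measure_pmf.prob ?M {x. \<kappa> * ln (real n) \<le> gap n x}
      = measure_pmf.prob ?M (- {x. \<kappa> * ln (real n) \<le> gap n x})"
    by (subst measure_pmf.prob_compl[symmetric]) (auto simp: Compl_eq_Diff_UNIV)
  also have "\<dots> \<le> measure_pmf.prob ?M {x. \<forall>i\<in>{1..n}. x i < nat \<lceil>3 * \<kappa> * ln (real n)\<rceil>}"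
  proof (rule measure_pmf.finite_measure_mono_AE)
    show "AE x in ?M. x \<in> - {x. \<kappa> * ln (real n) \<le> gap n x} \<longrightarrow>
        x \<in> {x. \<forall>i\<in>{1..n}. x i < nat \<lceil>3 * \<kappa> * ln (real n)\<rceil>}"
      unfolding AE_measure_pmf_iff
    proof (intro ballI impI CollectI)
      fix x i assume "x \<in> set_pmf ?M" "x \<in> - {x. \<kappa> * ln (real n) \<le> gap n x}" "i \<in> {1..n}"
      then show "x i < nat \<lceil>3 * \<kappa> * ln (real n)\<rceil>"
        using gap_ge[OF n _ \<open>\<kappa> \<ge> 0\<close>, of x i] load[of x] unfolding T by fastforce
    qed
  qed auto
  finally show ?thesis using prob by linarith
qed

section \<open>Choice of \<kappa>\<close>

text \<open>Apply \<open>reach_lower\<close> with \<open>h\<close> blocks of about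
  \<open>n / 256\<close> trials each. They fit into \<open>T div 64\<close> trials because
  \<open>3 / 256 < 1 / 64\<close>. The resulting bound on \<open>reach\<close> has order
  \<open>1 / sqrt n\<close>, so the exponent has order \<open>sqrt n\<close> and beats
  \<open>ln (2 * n)\<close>. The divisor 64 is the one needed for Mean-Thinning.\<close>

lemma ex_reach_exponent_le:
  fixes \<alpha> :: real
  assumes "0 < \<alpha>" "\<alpha> \<le> 1"
  shows "\<exists>\<kappa>>0. \<forall>\<^sub>F n in sequentially.
    exp (- (real n * reach (\<alpha> / real n) (nat \<lfloor>\<kappa> * real n * ln (real n)\<rfloor> div 64)
      (nat \<lceil>3 * \<kappa> * ln (real n)\<rceil>))) \<le> 1 / (2 * real n)"
proof -
  \<comment> \<open>A lower bound for the chance of a success within one block, whose length is at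
    least \<open>n / 512\<close>.\<close>
  define c where "c = 1 - exp (- \<alpha> / 512)"
  have c: "0 < c" "c < 1" using assms by (auto simp: c_def)
  \<comment> \<open>Chosen so that \<open>c powr (3 * \<kappa> * ln n)\<close> equals
    \<open>n powr - (1 / 2)\<close>.\<close>
  define \<kappa> where "\<kappa> = 1 / (6 * - ln c)"
  have \<kappa>: "\<kappa> > 0" using c by (auto simp: \<kappa>_def)
  have "\<forall>\<^sub>F n in sequentially. ln (2 * real n) \<le> c * sqrt (real n)"
    using c by real_asymp
  \<comment> \<open>This slack absorbs the rounding in \<open>h\<close>, in \<open>T\<close> and in
    \<open>T div 64\<close>.\<close>
  moreover have "\<forall>\<^sub>F n in sequentially. real n * (\<kappa> * ln (real n) - 1) / 256 \<ge> 2"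
    using \<kappa> by real_asymp
  moreover have "\<forall>\<^sub>F n in sequentially. n \<ge> (512::nat)" by (rule eventually_ge_at_top)
  ultimately have "\<forall>\<^sub>F n in sequentially.
    exp (- (real n * reach (\<alpha> / real n) (nat \<lfloor>\<kappa> * real n * ln (real n)\<rfloor> div 64)
      (nat \<lceil>3 * \<kappa> * ln (real n)\<rceil>))) \<le> 1 / (2 * real n)"
  proof eventually_elim
    case (elim n)
    define u b h T where "u = \<alpha> / real n" and "b = n div 256"
      and "h = nat \<lceil>3 * \<kappa> * ln (real n)\<rceil>" and "T = nat \<lfloor>\<kappa> * real n * ln (real n)\<rfloor>"
    have u: "0 \<le> u" "u \<le> 1" using assms elim by (auto simp: u_def divide_le_eq)
    have L: "0 \<le> ln (real n)" using elim by auto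
    have hr: "real h \<le> 3 * \<kappa> * ln (real n) + 1"
      using L \<kappa> unfolding h_def by (auto simp: of_nat_nat)
    have bu: "real b \<le> real n / 256" "real n / 512 \<le> real b"
      using elim(3) unfolding b_def by linarith+
    have Tl: "\<kappa> * real n * ln (real n) - 1 \<le> real T"
      unfolding T_def by linarith
    have "real (h * b) \<le> (3 * \<kappa> * ln (real n) + 1) * (real n / 256)"
      unfolding of_nat_mult using hr bu by (intro mult_mono) auto
    also have "\<dots> \<le> (\<kappa> * real n * ln (real n) - 1) / 64 - 1"
      using elim(2) by (simp add: field_simps)
    also have "\<dots> \<le> real (T div 64)"
    proof -
      have "T \<le> 64 * (T div 64) + 64" by presburger
      then have "real T \<le> 64 * real (T div 64) + 64" by linarith
      then show ?thesis using Tl by (simp add: algebra_simps)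
    qed
    finally have hb: "h * b \<le> T div 64" by (simp only: of_nat_le_iff)
    have "(1 - u) ^ b \<le> exp (- u) ^ b"
      using u exp_ge_add_one_self[of "- u"] by (intro power_mono) auto
    also have "\<dots> = exp (- (u * real b))" by (simp add: exp_of_nat_mult[symmetric] mult.commute)
    also have "\<dots> \<le> exp (- \<alpha> / 512)"
    proof -
      have "u * (real n / 512) \<le> u * real b" using bu u by (intro mult_left_mono) auto
      then show ?thesis using elim(3) by (simp add: u_def)
    qed
    finally have "c \<le> 1 - (1 - u) ^ b" by (simp add: c_def)
    then have "c ^ h \<le> (1 - (1 - u) ^ b) ^ h" using c by (intro power_mono) auto
    also have "\<dots> \<le> reach u (h * b) h" by (rule reach_lower[OF u])
    also have "\<dots> \<le> reach u (T div 64) h" by (rule reach_mono_rounds[OF u hb])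
    finally have R: "c ^ h \<le> reach u (T div 64) h" .
    have "c powr (3 * \<kappa> * ln (real n) + 1) \<le> c powr real h"
      using hr c by (simp add: powr_mono')
    also have "\<dots> = c ^ h" using c by (simp add: powr_realpow)
    also have "c powr (3 * \<kappa> * ln (real n) + 1) = c / sqrt (real n)"
    proof -
      have "(3 * \<kappa> * ln (real n)) * ln c = - (1 / 2) * ln (real n)" using c by (simp add: \<kappa>_def)
      then have "c powr (3 * \<kappa> * ln (real n)) = real n powr - (1 / 2)"
        using c elim(3) by (simp add: powr_def)
      then show ?thesis using c elim(3) by (simp add: powr_add powr_minus powr_half_sqrt field_simps)
    qed
    finally have "c / sqrt (real n) \<le> reach u (T div 64) h" using R by linarith
    then have "real n * (c / sqrt (real n)) \<le> real n * reach u (T div 64) h"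
      by (intro mult_left_mono) auto
    moreover have "real n * (c / sqrt (real n)) = c * (real n / sqrt (real n))" by simp
    moreover have "real n / sqrt (real n) = sqrt (real n)" by (simp add: real_div_sqrt)
    ultimately have "ln (2 * real n) \<le> real n * reach u (T div 64) h" using elim(1) by simp
    then have "exp (- (real n * reach u (T div 64) h)) \<le> exp (- ln (2 * real n))" by simp
    also have "\<dots> = 1 / (2 * real n)" using elim(3) by (simp add: exp_minus field_simps)
    finally show ?case by (simp add: u_def T_def h_def)
  qed
  then show ?thesis using \<kappa> by blast
qed

section \<open>Mean-Thinning on the clock of rejections\<close>

text \<open>
  Mean-Thinning, with the number of rejected first samples in the first component.
\<close>

definition thinning_step :: "nat \<Rightarrow> nat \<Rightarrow> nat \<times> load \<Rightarrow> (nat \<times> load) pmf" where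
  "thinning_step n t = (\<lambda>(k, x). do {
     i1 \<leftarrow> uniform_bin n;
     i2 \<leftarrow> uniform_bin n;
     return_pmf (if real (x i1) < real t / real n then (k, allocate 1 i1 x)
                 else (Suc k, allocate 1 i2 x))
   })"

primrec thinning_pmf :: "nat \<Rightarrow> nat \<Rightarrow> (nat \<times> load) pmf" where
  "thinning_pmf n 0 = return_pmf (0, \<lambda>_. 0)"
| "thinning_pmf n (Suc t) = thinning_pmf n t \<bind> thinning_step n t"

lemma map_snd_thinning_pmf: "map_pmf snd (thinning_pmf n t) = load_pmf mean_thinning n t"
proof (induction t)
  case (Suc t)
  have "map_pmf snd (thinning_step n t z) = mean_thinning n t (snd z)" for z
    by (cases z)
       (auto simp: thinning_step_def mean_thinning_def map_bind_pmf intro!: bind_pmf_cong)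
  then show ?case by (simp add: map_bind_pmf Suc[symmetric] bind_map_pmf)
qed simp

lemma finite_set_thinning_step: "n > 0 \<Longrightarrow> finite (set_pmf (thinning_step n t z))"
  unfolding thinning_step_def by (cases z) (simp add: set_uniform_bin)

lemma expectation_thinning_step:
  assumes "n > 0"
  shows "measure_pmf.expectation (thinning_step n t (k, x)) f =
    (\<Sum>i\<in>{1..n}. if real (x i) < real t / real n then f (k, allocate 1 i x)
       else (\<Sum>j\<in>{1..n}. f (Suc k, allocate 1 j x)) / real n) / real n"
proof -
  have one: "measure_pmf.expectation (uniform_bin n \<bind> (\<lambda>i. return_pmf (g i))) f
      = (\<Sum>i\<in>{1..n}. f (g i)) / real n" for g
    by (subst expectation_bind_finite)
       (use assms in \<open>simp_all add: expectation_uniform_bin set_uniform_bin\<close>)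
  have "measure_pmf.expectation (thinning_step n t (k, x)) f =
    (\<Sum>i\<in>{1..n}. (\<Sum>j\<in>{1..n}. f (if real (x i) < real t / real n then (k, allocate 1 i x)
       else (Suc k, allocate 1 j x))) / real n) / real n"
    unfolding thinning_step_def prod.case
    by (subst expectation_bind_finite)
       (use assms in \<open>simp_all only: expectation_uniform_bin one, simp_all add: set_uniform_bin\<close>)
  also have "\<dots> = (\<Sum>i\<in>{1..n}. if real (x i) < real t / real n then f (k, allocate 1 i x)
       else (\<Sum>j\<in>{1..n}. f (Suc k, allocate 1 j x)) / real n) / real n"
    using assms by (intro arg_cong[where f = "\<lambda>z. z / real n"] sum.cong) auto
  finally show ?thesis .
qed

text \<open>One ball per round makes the threshold \<open>t / n\<close> the exact average, so loads
  centred at it sum to 0.\<close>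

lemma total_load_thinning_pmf:
  assumes "n > 0" "(k, x) \<in> set_pmf (thinning_pmf n t)"
  shows "total_load n x = t"
  using assms(2)
proof (induction t arbitrary: k x)
  case 0
  then show ?case by (simp add: total_load_def)
next
  case (Suc t)
  then obtain l y where y: "(l, y) \<in> set_pmf (thinning_pmf n t)"
    "(k, x) \<in> set_pmf (thinning_step n t (l, y))" by auto
  then obtain i where "i \<in> {1..n}" "x = allocate 1 i y"
    using assms(1) unfolding thinning_step_def
    by (auto simp: set_uniform_bin split: if_splits)
  then show ?case using Suc.IH[OF y(1)] by (simp add: total_load_allocate)
qed

text \<open>The parameter of \<open>avoid\<close> is now the number \<open>m - k\<close> of
  rejections still to come. An accepted sample leaves it alone and can only lower the product; a
  rejected one throws a uniform ball and consumes one unit.\<close>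

lemma prob_rejections_ge:
  assumes "n > 0"
  shows "measure_pmf.prob (thinning_pmf n T) {(k, x). m \<le> k \<and> (\<forall>i\<in>{1..n}. x i < h)}
    \<le> exp (- (real n * reach (1 / real n) m h))"
proof -
  have u: "0 \<le> 1 / real n" "1 / real n \<le> 1" using assms by (auto simp: divide_le_eq)
  let ?V = "\<lambda>(k, x). avoid n (1 / real n) h (m - k) x"
  have "measure_pmf.prob (thinning_pmf n T) {(k, x). m \<le> k \<and> (\<forall>i\<in>{1..n}. x i < h)}
      \<le> measure_pmf.expectation (thinning_pmf n 0) ?V"
  proof (rule supermartingale_prob_le[where K = "thinning_step n" and V = "\<lambda>_. ?V"])
    fix t and z :: "nat \<times> load"
    obtain k x where z: "z = (k, x)" by (cases z)
    let ?v = "avoid n (1 / real n) h (m - k) x"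
    have rej: "(\<Sum>j\<in>{1..n}. avoid n (1 / real n) h (m - Suc k) (allocate 1 j x)) / real n \<le> ?v"
    proof (cases "k < m")
      case True
      then have "m - k = Suc (m - Suc k)" by simp
      then show ?thesis using avoid_average[OF assms, of 1 h "m - Suc k" x] by simp
    next
      \<comment> \<open>Both \<open>m - k\<close> and \<open>m - Suc k\<close> truncate to 0: the
        clock has stopped, and further balls only lower the product.\<close>
      case False
      have "(\<Sum>j\<in>{1..n}. avoid n (1 / real n) h (m - Suc k) (allocate 1 j x))
          \<le> (\<Sum>j\<in>{1..n}. ?v)"
        using False avoid_allocate_le[OF u] by (intro sum_mono) simp
      then show ?thesis using assms by (simp add: divide_le_eq mult.commute)
    qed
    have "measure_pmf.expectation (thinning_step n t z) ?V =
      (\<Sum>i\<in>{1..n}. if real (x i) < real t / real n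
         then avoid n (1 / real n) h (m - k) (allocate 1 i x)
         else (\<Sum>j\<in>{1..n}. avoid n (1 / real n) h (m - Suc k) (allocate 1 j x)) / real n) / real n"
      unfolding z expectation_thinning_step[OF assms] prod.case ..
    also have "\<dots> \<le> (\<Sum>i\<in>{1..n}. ?v) / real n"
      using rej avoid_allocate_le[OF u] by (intro divide_right_mono sum_mono) auto
    also have "\<dots> = ?v" using assms by simp
    finally show "measure_pmf.expectation (thinning_step n t z) ?V \<le> ?V z" by (simp add: z)
  qed (use assms finite_set_thinning_step avoid_nonneg[OF u] avoid_0[OF u] in auto)
  then show ?thesis using avoid_init[OF u, of n h m] by simp
qed

section \<open>Drift of the potential in Mean-Thinning\<close>

text \<open>A ball in an underloaded bin must raise this function by a definite amount. The
  exponential provides this near 0, the quadratic far below 0. Capping the exponent keeps the values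
  below 3, and the quadratic costs little as time passes because centred loads sum to 0.\<close>

definition bump :: "real \<Rightarrow> real" where
  "bump y = exp (min y 1) - y\<^sup>2 / 4"

lemma exp_min_shift:
  fixes y \<delta> :: real
  assumes "0 \<le> \<delta>"
  shows "exp (min y 1) * (1 - \<delta>) \<le> exp (min (y - \<delta>) 1)" "exp (min (y - \<delta>) 1) \<le> exp (min y 1)"
proof -
  have "exp (min y 1) * (1 - \<delta>) \<le> exp (min y 1) * exp (- \<delta>)"
    using exp_ge_add_one_self[of "- \<delta>"] by (intro mult_left_mono) auto
  also have "\<dots> = exp (min y 1 - \<delta>)" by (simp add: exp_add[symmetric])
  also have "\<dots> \<le> exp (min (y - \<delta>) 1)" using assms by auto
  finally show "exp (min y 1) * (1 - \<delta>) \<le> exp (min (y - \<delta>) 1)" .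
qed (use assms in auto)

lemma exp_min_le_3: "exp (min y 1) \<le> (3 :: real)"
proof -
  have "exp (min y 1) \<le> exp (1 :: real)" by simp
  then show ?thesis using exp_le by linarith
qed

lemma exp_1_ge: "(13 / 5 :: real) \<le> exp 1"
proof -
  have "(13 / 5 :: real) \<le> (1 + 1 / 12) ^ 12" by (simp add: power_divide field_simps)
  also have "\<dots> \<le> exp 1" using exp_ge_one_plus_x_over_n_power_n[of 12 1] by simp
  finally show ?thesis .
qed

text \<open>The first two terms are the share of the cost of passing time charged to an accepted
  first sample with centred load \<open>y\<close>; the bracket is the gain from its ball. The sum is
  at least \<open>exp y / 2 - y / 2 - 1 / 4\<close>, and \<open>exp y \<ge> 1 + y\<close>
  finishes.\<close>

lemma bump_drift_underloaded:
  fixes y \<delta> :: real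
  assumes "y < 0" "0 < \<delta>" "\<delta> \<le> 1 / 20"
  shows "1 / 4 \<le> - exp (min y 1) - \<delta> / 4 + (bump (y - \<delta> + 1) - bump (y - \<delta>))"
proof -
  have m: "min (y - \<delta> + 1) 1 = y - \<delta> + 1" "min (y - \<delta>) 1 = y - \<delta>" "min y 1 = y"
    using assms by auto
  have E: "bump (y - \<delta> + 1) - bump (y - \<delta>)
      = exp (y - \<delta>) * (exp 1 - 1) - y / 2 - 1 / 4 + \<delta> / 2"
    unfolding bump_def m exp_add by (simp add: power2_eq_square field_simps)
  have "exp y * (3 / 2) \<le> exp y * ((1 - \<delta>) * (exp 1 - 1))"
  proof (rule mult_left_mono)
    \<comment> \<open>Here \<open>8 / 5\<close> is \<open>13 / 5 - 1\<close> from
      \<open>exp_1_ge\<close>; the product is 1.52.\<close>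
    have "(19 / 20) * (8 / 5) \<le> (1 - \<delta>) * (exp 1 - 1)"
      using assms exp_1_ge by (intro mult_mono) auto
    then show "3 / 2 \<le> (1 - \<delta>) * (exp 1 - 1)" by linarith
  qed auto
  also have "\<dots> = exp y * (1 - \<delta>) * (exp 1 - 1)" by simp
  also have "\<dots> \<le> exp (y - \<delta>) * (exp 1 - 1)"
    using exp_min_shift(1)[of \<delta> y] assms exp_1_ge m by (intro mult_right_mono) auto
  finally have "1 / 2 * exp y - y / 2 - 1 / 4 \<le> - exp y + exp (y - \<delta>) * (exp 1 - 1) - y / 2 - 1 / 4"
    by linarith
  moreover have "1 / 2 \<le> 1 / 2 * exp y - y / 2" using exp_ge_add_one_self[of y] by linarith
  ultimately show ?thesis unfolding E m using assms by linarith
qed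

definition potential :: "nat \<Rightarrow> nat \<Rightarrow> load \<Rightarrow> real" where
  "potential n t x = (\<Sum>i\<in>{1..n}. bump (real (x i) - real t / real n))"

lemma potential_allocate:
  assumes "j \<in> {1..n}"
  shows "potential n t (allocate 1 j x) = potential n t x
    + (bump (real (x j) - real t / real n + 1) - bump (real (x j) - real t / real n))"
  unfolding potential_def allocate_def using assms
  by (subst (1 2) sum.remove[of _ j]) (auto simp: algebra_simps intro!: sum.cong)

text \<open>A round is split in two: \<open>D\<close> is the change of the potential when the
  average rises by \<delta> and no ball is placed, and \<open>a i\<close> is the further change when
  bin \<open>i\<close> then receives the ball.\<close>

context
  fixes n t :: nat and x :: load and y :: "nat \<Rightarrow> real" and \<delta> D :: real and a :: "nat \<Rightarrow> real"
  assumes n: "n \<ge> 20" and load: "total_load n x = t"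
  defines "\<delta> \<equiv> 1 / real n"
  defines "y \<equiv> \<lambda>i. real (x i) - real t / real n"
  defines "D \<equiv> potential n (Suc t) x - potential n t x"
  defines "a \<equiv> \<lambda>i. bump (y i - \<delta> + 1) - bump (y i - \<delta>)"
begin

lemma inverse_bins: "0 < \<delta>" "\<delta> \<le> 1 / 20" "real n * \<delta> = 1"
  using n by (auto simp: \<delta>_def field_simps)

lemma sum_centred_loads: "(\<Sum>i\<in>{1..n}. y i) = 0"
  using load n by (simp add: y_def sum_subtractf total_load_def flip: of_nat_sum)

text \<open>The quadratic parts contribute \<open>\<delta> / 2 * y i - \<delta>\<^sup>2 / 4\<close>
  each; the linear terms cancel in the sum and the rest adds up to
  \<open>- \<delta> / 4\<close>.\<close>

lemma idle_increment_eq: "D = (\<Sum>i\<in>{1..n}. exp (min (y i - \<delta>) 1) - exp (min (y i) 1)) - \<delta> / 4"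
proof -
  have "D = (\<Sum>i\<in>{1..n}. bump (y i - \<delta>) - bump (y i))"
    unfolding D_def potential_def y_def \<delta>_def
    by (simp add: sum_subtractf[symmetric] add_divide_distrib algebra_simps)
  also have "\<dots> = (\<Sum>i\<in>{1..n}. (exp (min (y i - \<delta>) 1) - exp (min (y i) 1)) + (\<delta> / 2 * y i - \<delta>\<^sup>2 / 4))"
    by (intro sum.cong) (auto simp: bump_def power2_eq_square field_simps)
  also have "\<dots> = (\<Sum>i\<in>{1..n}. exp (min (y i - \<delta>) 1) - exp (min (y i) 1))
      + (\<delta> / 2 * (\<Sum>i\<in>{1..n}. y i) - real n * (\<delta>\<^sup>2 / 4))"
    by (simp only: sum.distrib sum_subtractf sum_distrib_left[symmetric]) simp
  also have "real n * (\<delta>\<^sup>2 / 4) = \<delta> / 4"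
    using inverse_bins(3) by (simp add: power2_eq_square mult.assoc[symmetric])
  finally show ?thesis using sum_centred_loads by simp
qed

text \<open>The lower bound is written as an average over bins so that it can be charged to the
  uniformly drawn first sample.\<close>

lemma idle_increment_bounds: "(\<Sum>i\<in>{1..n}. - exp (min (y i) 1) - \<delta> / 4) / real n \<le> D" "D \<le> 0"
proof -
  have "(\<Sum>i\<in>{1..n}. - exp (min (y i) 1) - \<delta> / 4) / real n
      = (\<Sum>i\<in>{1..n}. - (\<delta> * exp (min (y i) 1))) - \<delta> / 4"
    using n by (simp add: sum_subtractf sum_negf diff_divide_distrib sum_divide_distrib \<delta>_def)
  also have "\<dots> \<le> D"
    unfolding idle_increment_eq using exp_min_shift(1)[of \<delta>] inverse_bins(1)
    by (intro diff_right_mono sum_mono) (simp add: algebra_simps)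
  finally show "(\<Sum>i\<in>{1..n}. - exp (min (y i) 1) - \<delta> / 4) / real n \<le> D" .
  have "(\<Sum>i\<in>{1..n}. exp (min (y i - \<delta>) 1) - exp (min (y i) 1)) \<le> 0"
    using exp_min_shift(2)[of \<delta>] inverse_bins(1) by (intro sum_nonpos) simp
  then show "D \<le> 0" unfolding idle_increment_eq using inverse_bins(1) by simp
qed

lemma ball_increment_eq: "a i = (exp (min (y i - \<delta> + 1) 1) - exp (min (y i - \<delta>) 1)) - y i / 2 - 1 / 4 + \<delta> / 2"
  by (simp add: a_def bump_def power2_eq_square field_simps)

lemma ball_increment_bounds: "- y i / 2 - 1 / 4 \<le> a i" "a i \<le> 3 - y i / 2"
proof -
  have "exp (min (y i - \<delta>) 1) \<le> exp (min (y i - \<delta> + 1) 1)"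
    "exp (min (y i - \<delta> + 1) 1) \<le> 3" "0 < exp (min (y i - \<delta>) 1)"
    using exp_min_le_3 by auto
  then show "- y i / 2 - 1 / 4 \<le> a i" "a i \<le> 3 - y i / 2"
    unfolding ball_increment_eq using inverse_bins(1,2) by linarith+
qed

lemma mean_ball_increment: "- 1 / 4 \<le> (\<Sum>j\<in>{1..n}. a j) / real n"
proof -
  have "(\<Sum>j\<in>{1..n}. - y j / 2 - 1 / 4) \<le> (\<Sum>j\<in>{1..n}. a j)"
    using ball_increment_bounds by (intro sum_mono)
  also have "(\<Sum>j\<in>{1..n}. - y j / 2 - 1 / 4) = - real n / 4"
    using sum_centred_loads by (simp add: sum_subtractf sum_negf sum_divide_distrib[symmetric])
  finally show ?thesis using n by (simp add: field_simps)
qed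

text \<open>With the cost of \<open>D\<close> distributed over the first sample, the drift is at
  least \<open>1 / 4\<close> for each outcome of that sample separately.\<close>

lemma potential_drift:
  "1 / 4 \<le> (\<Sum>i\<in>{1..n}. if y i < 0 then D + a i else (\<Sum>j\<in>{1..n}. D + a j + 4) / real n) / real n"
proof -
  have avg: "(\<Sum>j\<in>{1..n}. D + a j + 4) / real n = D + 4 + (\<Sum>j\<in>{1..n}. a j) / real n"
    using n by (simp add: sum.distrib field_simps)
  have "1 / 4 = (\<Sum>i\<in>{1..n}. 1 / 4 :: real) / real n" using n by simp
  also have "\<dots> \<le> (\<Sum>i\<in>{1..n}. (- exp (min (y i) 1) - \<delta> / 4) +
      (if y i < 0 then a i else 4 + (\<Sum>j\<in>{1..n}. a j) / real n)) / real n"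
  proof (intro divide_right_mono sum_mono)
    fix i
    \<comment> \<open>For a rejected sample the credit 4 covers the idle cost of at most
      \<open>3 + \<delta> / 4\<close> and the mean loss \<open>1 / 4\<close> from a uniform
      ball.\<close>
    show "1 / 4 \<le> (- exp (min (y i) 1) - \<delta> / 4) +
      (if y i < 0 then a i else 4 + (\<Sum>j\<in>{1..n}. a j) / real n)"
      using bump_drift_underloaded[of "y i" \<delta>] exp_min_le_3[of "y i"] mean_ball_increment inverse_bins
      by (auto simp: a_def)
  qed auto
  also have "\<dots> \<le> D + (\<Sum>i\<in>{1..n}. if y i < 0 then a i else 4 + (\<Sum>j\<in>{1..n}. a j) / real n) / real n"
    unfolding sum.distrib add_divide_distrib using idle_increment_bounds(1) by simp
  also have "\<dots> = (\<Sum>i\<in>{1..n}. D + (if y i < 0 then a i else 4 + (\<Sum>j\<in>{1..n}. a j) / real n)) / real n"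
    using n by (simp add: sum.distrib add_divide_distrib)
  also have "\<dots> = (\<Sum>i\<in>{1..n}. if y i < 0 then D + a i else (\<Sum>j\<in>{1..n}. D + a j + 4) / real n) / real n"
    unfolding avg by (intro arg_cong[where f = "\<lambda>z. z / real n"] sum.cong) auto
  finally show ?thesis .
qed

lemma increment_bounds:
  assumes "\<bar>y j\<bar> \<le> H"
  shows "\<bar>D + a j\<bar> \<le> 4 + H"
proof -
  have "- 13 / 4 \<le> (\<Sum>i\<in>{1..n}. - exp (min (y i) 1) - \<delta> / 4) / real n"
  proof -
    have "(\<Sum>i\<in>{1..n}. - 13 / 4 :: real) \<le> (\<Sum>i\<in>{1..n}. - exp (min (y i) 1) - \<delta> / 4)"
    proof (rule sum_mono)
      fix i show "- 13 / 4 \<le> - exp (min (y i) 1) - \<delta> / 4"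
        using exp_min_le_3[of "y i"] inverse_bins by linarith
    qed
    then show ?thesis using n by (simp add: field_simps)
  qed
  then show ?thesis using idle_increment_bounds ball_increment_bounds[of j] assms by linarith
qed

lemma potential_Suc_allocate:
  assumes "j \<in> {1..n}"
  shows "potential n (Suc t) (allocate 1 j x) = potential n t x + (D + a j)"
  unfolding potential_allocate[OF assms] D_def a_def y_def \<delta>_def
  by (simp add: add_divide_distrib algebra_simps)

end

section \<open>Exponential supermartingale against few rejections\<close>

lemma exp_le_quadratic:
  fixes z :: real
  assumes "\<bar>z\<bar> \<le> 1"
  shows "exp z \<le> 1 + z + z\<^sup>2"
proof (cases "0 \<le> z")
  case True
  then show ?thesis using exp_bound[of z] assms by auto
next
  case False
  have "exp z = 1 / exp (- z)" by (simp add: exp_minus field_simps)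
  also have "\<dots> \<le> 1 / (1 - z)"
    using False exp_ge_add_one_self[of "- z"] by (intro divide_left_mono mult_pos_pos) auto
  also have "\<dots> \<le> 1 + z + z\<^sup>2"
  proof -
    have "(1 + z + z\<^sup>2) * (1 - z) = 1 - z ^ 3" by (simp add: power2_eq_square power3_eq_cube algebra_simps)
    moreover have "z ^ 3 \<le> 0" using False by (simp add: power_le_zero_eq)
    ultimately show ?thesis using False by (simp add: divide_le_eq)
  qed
  finally show ?thesis .
qed

text \<open>Half of the drift \<open>1 / 4\<close> is spent on the term \<open>real t / 8\<close> in
  the exponent, the other half on the second-order error of the exponential. The potential is at
  most \<open>3 * n\<close> at time \<open>T\<close>, which bounds the exponent on the event in
  question.\<close>

lemma prob_rejections_less:
  assumes n: "n \<ge> 20" and H: "real h \<le> H" "real T / real n \<le> H"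
  defines "s \<equiv> 1 / (8 * (9 + H)\<^sup>2)"
  shows "measure_pmf.prob (thinning_pmf n T) {(k, x). k < m \<and> (\<forall>i\<in>{1..n}. x i < h)}
    \<le> exp (s * (3 * real n + 4 * real m - real T / 8))"
proof -
  have n0: "n > 0" using n by simp
  have H0: "0 \<le> H" using H by simp
  \<comment> \<open>Bounds \<open>\<bar>Z\<bar>\<close> below: \<open>4 + H\<close> from a ball and
    the shift of the average, 4 from a rejection, \<open>1 / 8\<close> from the compensator.\<close>
  define B where "B = 9 + H"
  have B: "9 \<le> B" "s = 1 / (8 * (B * B))" using H0 by (auto simp: B_def s_def power2_eq_square)
  then have s: "0 < s" "s * B \<le> 1" "s * B\<^sup>2 = 1 / 8"
    by (auto simp: power2_eq_square)
  \<comment> \<open>Normalises \<open>W\<close> to be at least 1 at time \<open>T\<close> on the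
    event to be bounded.\<close>
  define C where "C = s * (3 * real n + 4 * real m - real T / 8)"
  \<comment> \<open>Set to 0 once a bin is full, since increments are controlled only while all
    loads stay below \<open>h\<close>; loads never decrease, so it stays 0.\<close>
  define W where "W = (\<lambda>t (k, x). if \<forall>i\<in>{1..n}. x i < h
     then exp (C - s * (potential n t x + 4 * real k - real t / 8)) else 0)"
  have W_nonneg: "0 \<le> W t z" for t z by (auto simp: W_def split: prod.splits)
  have "measure_pmf.prob (thinning_pmf n T) {(k, x). k < m \<and> (\<forall>i\<in>{1..n}. x i < h)}
      \<le> measure_pmf.expectation (thinning_pmf n 0) (W 0)"
  proof (rule supermartingale_prob_le[where K = "thinning_step n" and V = W])
    fix t and z :: "nat \<times> load"
    assume t: "t < T" and z: "z \<in> set_pmf (thinning_pmf n t)"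
    obtain k x where kx: "z = (k, x)" by (cases z)
    have load: "total_load n x = t" using total_load_thinning_pmf[OF n0] z kx by blast
    define y where "y = (\<lambda>i. real (x i) - real t / real n)"
    define D where "D = potential n (Suc t) x - potential n t x"
    define a where "a = (\<lambda>i. bump (y i - 1 / real n + 1) - bump (y i - 1 / real n))"
    note defs = y_def D_def a_def
    let ?w = "W t z"
    \<comment> \<open>An upper bound for the next value of \<open>W\<close> that is affine in the
      increment \<open>v\<close>, so averages over both samples pass through it and only the mean
      drift matters.\<close>
    define \<phi> where "\<phi> = (\<lambda>v. ?w * (1 + s / 8) + (- ?w * s) * (v - 1 / 8))"
    have step: "W (Suc t) (k', allocate 1 j x) \<le> \<phi> (D + a j + 4 * (real k' - real k))"
      if j: "j \<in> {1..n}" and k': "k' = k \<or> k' = Suc k" for j k'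
    proof (cases "\<forall>i\<in>{1..n}. x i < h")
      case False
      then obtain i where i: "i \<in> {1..n}" "h \<le> x i" by (auto simp: not_less)
      then have "h \<le> allocate 1 j x i" by (auto simp: allocate_def)
      then have "W (Suc t) (k', allocate 1 j x) = 0" using i(1) by (auto simp: W_def not_less[symmetric])
      moreover have "?w = 0" using False by (simp add: W_def kx)
      ultimately show ?thesis by (simp add: \<phi>_def)
    next
      case True
      define Z where "Z = D + a j + 4 * (real k' - real k) - 1 / 8"
      have "real t / real n \<le> H"
        using H(2) t by (meson divide_right_mono less_imp_le of_nat_0_le_iff of_nat_le_iff order_trans)
      moreover have "real (x j) \<le> H" using True j H(1) by (meson less_imp_le of_nat_le_iff order_trans)
      moreover have "0 \<le> real t / real n" by simp
      ultimately have yH: "\<bar>y j\<bar> \<le> H" unfolding y_def by linarith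
      from increment_bounds[OF n load, of j H] yH have "\<bar>D + a j\<bar> \<le> 4 + H"
        by (simp add: defs)
      moreover have "0 \<le> real k' - real k" "real k' - real k \<le> 1" using k' by auto
      ultimately have ZB: "\<bar>Z\<bar> \<le> B" unfolding Z_def B_def by (auto simp: abs_le_iff)
      have "\<bar>- s * Z\<bar> = s * \<bar>Z\<bar>" using s by (simp add: abs_mult)
      also have "\<dots> \<le> s * B" using ZB s by (intro mult_left_mono) auto
      finally have sZ: "\<bar>- s * Z\<bar> \<le> 1" using s by linarith
      have pot: "potential n (Suc t) (allocate 1 j x) = potential n t x + (D + a j)"
        using potential_Suc_allocate[OF n load j] by (simp add: defs)
      have "W (Suc t) (k', allocate 1 j x)
          \<le> exp (C - s * (potential n (Suc t) (allocate 1 j x) + 4 * real k' - real (Suc t) / 8))"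
        by (simp add: W_def)
      also have "C - s * (potential n (Suc t) (allocate 1 j x) + 4 * real k' - real (Suc t) / 8)
          = (C - s * (potential n t x + 4 * real k - real t / 8)) + - s * Z"
        unfolding pot Z_def by (simp add: algebra_simps add_divide_distrib)
      also have "exp \<dots> = ?w * exp (- s * Z)"
        unfolding exp_add using True by (simp add: W_def kx)
      also have "\<dots> \<le> ?w * (1 + - s * Z + (- s * Z)\<^sup>2)"
        using exp_le_quadratic[OF sZ] W_nonneg by (intro mult_left_mono) auto
      also have "\<dots> \<le> ?w * (1 + - s * Z + s / 8)"
      proof -
        have "Z\<^sup>2 \<le> B\<^sup>2" using ZB by (simp add: abs_le_square_iff[symmetric])
        then have "(s * s) * Z\<^sup>2 \<le> (s * s) * B\<^sup>2" using s by (intro mult_left_mono) auto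
        also have "\<dots> = s * (s * B\<^sup>2)" by simp
        also have "\<dots> = s / 8" unfolding s(3) by simp
        also have "(s * s) * Z\<^sup>2 = (- s * Z)\<^sup>2" by (simp add: power2_eq_square)
        finally have "(- s * Z)\<^sup>2 \<le> s / 8" .
        then show ?thesis using W_nonneg by (intro mult_left_mono) auto
      qed
      also have "\<dots> = \<phi> (D + a j + 4 * (real k' - real k))"
        by (simp add: \<phi>_def Z_def algebra_simps)
      finally show ?thesis .
    qed
    have affine: "(\<Sum>j\<in>{1..n}. \<phi> (v j)) / real n = \<phi> ((\<Sum>j\<in>{1..n}. v j) / real n)" for v
    proof -
      define p q where "p = ?w * (1 + s / 8) + ?w * s / 8" and "q = - ?w * s"
      have "\<phi> v = p + q * v" for v by (simp add: \<phi>_def p_def q_def algebra_simps)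
      then show ?thesis using n0
        by (simp add: sum.distrib sum_distrib_left[symmetric] add_divide_distrib)
    qed
    have "measure_pmf.expectation (thinning_step n t z) (W (Suc t)) =
      (\<Sum>i\<in>{1..n}. if real (x i) < real t / real n then W (Suc t) (k, allocate 1 i x)
         else (\<Sum>j\<in>{1..n}. W (Suc t) (Suc k, allocate 1 j x)) / real n) / real n"
      unfolding kx expectation_thinning_step[OF n0] ..
    also have "\<dots> \<le> (\<Sum>i\<in>{1..n}. if real (x i) < real t / real n then \<phi> (D + a i)
         else (\<Sum>j\<in>{1..n}. \<phi> (D + a j + 4)) / real n) / real n"
    proof (intro divide_right_mono sum_mono)
      fix i assume i: "i \<in> {1..n}"
      have "(\<Sum>j\<in>{1..n}. W (Suc t) (Suc k, allocate 1 j x)) \<le> (\<Sum>j\<in>{1..n}. \<phi> (D + a j + 4))"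
        using step[of _ "Suc k"] by (intro sum_mono) simp
      from divide_right_mono[OF this, of "real n"]
      show "(if real (x i) < real t / real n then W (Suc t) (k, allocate 1 i x)
         else (\<Sum>j\<in>{1..n}. W (Suc t) (Suc k, allocate 1 j x)) / real n)
        \<le> (if real (x i) < real t / real n then \<phi> (D + a i)
         else (\<Sum>j\<in>{1..n}. \<phi> (D + a j + 4)) / real n)"
        using step[OF i, of k] by simp
    qed auto
    also have "\<dots> = (\<Sum>i\<in>{1..n}. \<phi> (if y i < 0 then D + a i else (\<Sum>j\<in>{1..n}. D + a j + 4) / real n)) / real n"
      unfolding affine[of "\<lambda>j. D + a j + 4"] y_def by (intro arg_cong[where f = "\<lambda>z. z / real n"] sum.cong) auto
    also have "\<dots> = \<phi> ((\<Sum>i\<in>{1..n}. if y i < 0 then D + a i else (\<Sum>j\<in>{1..n}. D + a j + 4) / real n) / real n)"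
      by (rule affine)
    \<comment> \<open>\<phi> is nonincreasing and takes the current value of \<open>W\<close> at
      \<open>1 / 4\<close>.\<close>
    also have "\<dots> \<le> \<phi> (1 / 4)"
    proof -
      have drift: "1 / 4 \<le> (\<Sum>i\<in>{1..n}. if y i < 0 then D + a i else (\<Sum>j\<in>{1..n}. D + a j + 4) / real n) / real n"
        unfolding defs by (rule potential_drift[OF n load])
      have "- ?w * s \<le> 0" using W_nonneg[of t z] s by simp
      then show ?thesis unfolding \<phi>_def
        by (intro add_left_mono mult_left_mono_neg diff_right_mono drift)
    qed
    also have "\<phi> (1 / 4) = ?w" by (simp add: \<phi>_def algebra_simps)
    finally show "measure_pmf.expectation (thinning_step n t z) (W (Suc t)) \<le> W t z" .
  next
    fix z :: "nat \<times> load"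
    assume "z \<in> {(k, x). k < m \<and> (\<forall>i\<in>{1..n}. x i < h)}"
    then obtain k x where kx: "z = (k, x)" "k < m" "\<forall>i\<in>{1..n}. x i < h" by auto
    have "potential n T x \<le> (\<Sum>i\<in>{1..n}. 3)" unfolding potential_def
    proof (rule sum_mono)
      fix i show "bump (real (x i) - real T / real n) \<le> 3"
        using exp_min_le_3[of "real (x i) - real T / real n"] by (simp add: bump_def add_increasing2 diff_le_eq)
    qed
    then have "potential n T x + 4 * real k - real T / 8 \<le> 3 * real n + 4 * real m - real T / 8"
      using kx(2) by simp
    then have "s * (potential n T x + 4 * real k - real T / 8) \<le> C"
      unfolding C_def using s by (intro mult_left_mono) auto
    then show "1 \<le> W T z" using kx by (simp add: W_def)
  qed (use n0 finite_set_thinning_step W_nonneg in auto)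
  also have "\<dots> \<le> exp C"
  proof -
    have "potential n 0 (\<lambda>_. 0) = real n" by (simp add: potential_def bump_def)
    then show ?thesis using s by (simp add: W_def)
  qed
  finally show ?thesis by (simp add: C_def)
qed

section \<open>Asymptotics and assembly\<close>

text \<open>Since \<open>4 * (T div 64) \<le> T / 16\<close>, at least half of \<open>T / 8\<close>
  survives. This has order \<open>n * ln n\<close> and dominates \<open>3 * n\<close>; division by a
  multiple of \<open>(ln n)\<^sup>2\<close> still leaves far more than
  \<open>ln (2 * n)\<close>.\<close>

lemma eventually_rejections_bound_le:
  fixes \<kappa> :: real
  assumes "\<kappa> > 0"
  shows "\<forall>\<^sub>F n in sequentially.
    exp (1 / (8 * (9 + (3 * \<kappa> * ln (real n) + 1))\<^sup>2) *
      (3 * real n + 4 * real (nat \<lfloor>\<kappa> * real n * ln (real n)\<rfloor> div 64)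
        - real (nat \<lfloor>\<kappa> * real n * ln (real n)\<rfloor>) / 8)) \<le> 1 / (2 * real n)"
proof -
  have "\<forall>\<^sub>F n in sequentially. 1 / (8 * (9 + (3 * \<kappa> * ln (real n) + 1))\<^sup>2) *
      (3 * real n + 1 - \<kappa> * real n * ln (real n) / 16) \<le> - ln (2 * real n)"
    using assms by real_asymp
  moreover have "\<forall>\<^sub>F n in sequentially. n > (0::nat)" by (rule eventually_gt_at_top)
  ultimately show ?thesis
  proof eventually_elim
    case (elim n)
    define T where "T = nat \<lfloor>\<kappa> * real n * ln (real n)\<rfloor>"
    let ?s = "1 / (8 * (9 + (3 * \<kappa> * ln (real n) + 1))\<^sup>2)"
    have "\<kappa> * real n * ln (real n) - 1 \<le> real T" unfolding T_def by linarith
    moreover have "real (T div 64) \<le> real T / 64" by linarith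
    ultimately have "3 * real n + 4 * real (T div 64) - real T / 8
        \<le> 3 * real n + 1 - \<kappa> * real n * ln (real n) / 16" by linarith
    then have "?s * (3 * real n + 4 * real (T div 64) - real T / 8)
        \<le> ?s * (3 * real n + 1 - \<kappa> * real n * ln (real n) / 16)"
      by (intro mult_left_mono) auto
    also have "\<dots> \<le> - ln (2 * real n)" by (rule elim)
    finally have "exp (?s * (3 * real n + 4 * real (T div 64) - real T / 8)) \<le> exp (- ln (2 * real n))"
      by simp
    also have "\<dots> = 1 / (2 * real n)" using elim(2) by (simp add: exp_minus field_simps)
    finally show ?case by (simp add: T_def)
  qed
qed

lemma mean_thinning_max_less:
  fixes \<kappa> :: real
  assumes n: "n \<ge> 20" and "\<kappa> > 0"
    and T: "T = nat \<lfloor>\<kappa> * real n * ln (real n)\<rfloor>" and h: "h = nat \<lceil>3 * \<kappa> * ln (real n)\<rceil>"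
  shows "measure_pmf.prob (load_pmf mean_thinning n T) {x. \<forall>i\<in>{1..n}. x i < h}
    \<le> exp (- (real n * reach (1 / real n) (T div 64) h))
    + exp (1 / (8 * (9 + (3 * \<kappa> * ln (real n) + 1))\<^sup>2) *
        (3 * real n + 4 * real (T div 64) - real T / 8))"
proof -
  let ?P = "measure_pmf.prob (thinning_pmf n T)"
  have L: "0 \<le> \<kappa> * ln (real n)" using assms by auto
  have hH: "real h \<le> 3 * \<kappa> * ln (real n) + 1" using L unfolding h by (auto simp: of_nat_nat)
  have "real T \<le> \<kappa> * ln (real n) * real n" 
  proof -
    have "0 \<le> \<kappa> * real n * ln (real n)" using assms by auto
    then have "real T \<le> \<kappa> * real n * ln (real n)" unfolding T by auto
    then show ?thesis by (simp add: mult_ac)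
  qed
  then have "real T / real n \<le> \<kappa> * ln (real n)" using n by (simp add: divide_le_eq)
  then have TH: "real T / real n \<le> 3 * \<kappa> * ln (real n) + 1" using L by linarith
  have "measure_pmf.prob (load_pmf mean_thinning n T) {x. \<forall>i\<in>{1..n}. x i < h}
      = ?P (snd -` {x. \<forall>i\<in>{1..n}. x i < h})"
    by (simp add: map_snd_thinning_pmf[symmetric])
  also have "snd -` {x. \<forall>i\<in>{1..n}. x i < h}
      = {(k, x). T div 64 \<le> k \<and> (\<forall>i\<in>{1..n}. x i < h)} \<union> {(k, x). k < T div 64 \<and> (\<forall>i\<in>{1..n}. x i < h)}"
    by auto
  also have "?P \<dots> \<le> ?P {(k, x). T div 64 \<le> k \<and> (\<forall>i\<in>{1..n}. x i < h)}
      + ?P {(k, x). k < T div 64 \<and> (\<forall>i\<in>{1..n}. x i < h)}"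
    by (rule measure_Un_le) auto
  also have "\<dots> \<le> exp (- (real n * reach (1 / real n) (T div 64) h))
    + exp (1 / (8 * (9 + (3 * \<kappa> * ln (real n) + 1))\<^sup>2) *
        (3 * real n + 4 * real (T div 64) - real T / 8))"
    using n by (intro add_mono prob_rejections_ge prob_rejections_less[OF n hH TH]) auto
  finally show ?thesis .
qed

text \<open>Lets the two processes that use all \<open>T\<close> rounds share the estimate made for
  \<open>T div 64\<close> trials.\<close>

lemma reach_decay:
  assumes "0 \<le> u" "u \<le> 1"
  shows "exp (- (real n * reach u T h)) \<le> exp (- (real n * reach u (T div 64) h))"
  using reach_mono_rounds[OF assms, of "T div 64" T h] by (simp add: mult_left_mono)

theorem corollary8p3:
  fixes \<beta> :: real and S :: step
  assumes "0 < \<beta>" and "\<beta> < 1"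
    and "S \<in> {mean_thinning, twinning, one_plus_beta \<beta>}"
  shows "\<exists>\<kappa>>0. \<forall>\<^sub>F n in sequentially.
    measure_pmf.prob (load_pmf S n (nat \<lfloor>\<kappa> * real n * ln (real n)\<rfloor>))
      {x. gap n x \<ge> \<kappa> * ln (real n)} \<ge> 1 - 1 / real n"
proof -
  \<comment> \<open>The probability that a ball is thrown uniformly: per round, or per rejection in
    Mean-Thinning.\<close>
  define \<alpha> where "\<alpha> = (if S = one_plus_beta \<beta> then 1 - \<beta> else 1)"
  have \<alpha>: "0 < \<alpha>" "\<alpha> \<le> 1" using assms by (auto simp: \<alpha>_def)
  obtain \<kappa> where \<kappa>: "\<kappa> > 0" and R: "\<forall>\<^sub>F n in sequentially.
    exp (- (real n * reach (\<alpha> / real n) (nat \<lfloor>\<kappa> * real n * ln (real n)\<rfloor> div 64)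
      (nat \<lceil>3 * \<kappa> * ln (real n)\<rceil>))) \<le> 1 / (2 * real n)"
    using ex_reach_exponent_le[OF \<alpha>] by blast
  have "\<forall>\<^sub>F n in sequentially. 20 \<le> (n::nat)" by (rule eventually_ge_at_top)
  then have "\<forall>\<^sub>F n in sequentially.
    measure_pmf.prob (load_pmf S n (nat \<lfloor>\<kappa> * real n * ln (real n)\<rfloor>))
      {x. gap n x \<ge> \<kappa> * ln (real n)} \<ge> 1 - 1 / real n"
    using R eventually_rejections_bound_le[OF \<kappa>]
  proof eventually_elim
    case (elim n)
    define T where "T = nat \<lfloor>\<kappa> * real n * ln (real n)\<rfloor>"
    define h where "h = nat \<lceil>3 * \<kappa> * ln (real n)\<rceil>"
    have n: "n > 0" using elim(1) by simp
    have u: "0 \<le> \<alpha> / real n" "\<alpha> / real n \<le> 1" using \<alpha> n by (auto simp: divide_le_eq)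
    have single: "exp (- (real n * reach (\<alpha> / real n) T h)) \<le> 1 / real n"
    proof -
      have "exp (- (real n * reach (\<alpha> / real n) T h)) \<le> 1 / (2 * real n)"
        by (rule order_trans[OF reach_decay[OF u] elim(2)[folded T_def h_def]])
      also have "\<dots> \<le> 1 / real n" using n by (simp add: field_simps)
      finally show ?thesis .
    qed
    have "total_load n x \<le> 2 * T" if "x \<in> set_pmf (load_pmf S n T)" for x
    proof (cases "S = mean_thinning")
      case True
      then have "x \<in> snd ` set_pmf (thinning_pmf n T)"
        using that by (simp add: map_snd_thinning_pmf[symmetric])
      then show ?thesis using total_load_thinning_pmf[OF n] by force
    next
      case False
      then show ?thesis
        using assms(3) that total_load_le[of twinning n x T, OF set_twinning[OF n]]
          total_load_le[of "one_plus_beta \<beta>" n x T, OF set_one_plus_beta[OF n]] by auto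
    qed
    moreover have "measure_pmf.prob (load_pmf S n T) {x. \<forall>i\<in>{1..n}. x i < h} \<le> 1 / real n"
    proof -
      \<comment> \<open>The split follows the test in \<alpha>, so the three processes need not be
        shown to be distinct.\<close>
      consider "S = one_plus_beta \<beta>" | "S = twinning" "\<alpha> = 1" | "S = mean_thinning" "\<alpha> = 1"
        using assms(3) unfolding \<alpha>_def by (cases "S = one_plus_beta \<beta>") auto
      then show ?thesis
      proof cases
        case 1
        then have "\<alpha> = 1 - \<beta>" by (simp add: \<alpha>_def)
        then have "measure_pmf.prob (load_pmf S n T) {x. \<forall>i\<in>{1..n}. x i < h}
            \<le> exp (- (real n * reach (\<alpha> / real n) T h))"
          using 1 assms(1,2) avoid_one_plus_beta[OF n] finite_set_one_plus_beta[OF n]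
          by (intro prob_max_less_le[OF n u]) auto
        then show ?thesis using single by linarith
      next
        case 2
        then have "measure_pmf.prob (load_pmf S n T) {x. \<forall>i\<in>{1..n}. x i < h}
            \<le> exp (- (real n * reach (\<alpha> / real n) T h))"
          using avoid_twinning[OF n] finite_set_twinning[OF n]
          by (intro prob_max_less_le[OF n u]) auto
        then show ?thesis using single by linarith
      next
        case 3
        then have "measure_pmf.prob (load_pmf S n T) {x. \<forall>i\<in>{1..n}. x i < h}
            \<le> 1 / (2 * real n) + 1 / (2 * real n)"
          using mean_thinning_max_less[OF elim(1) \<kappa> T_def h_def] elim(2,3)
          unfolding T_def h_def by simp
        also have "\<dots> = 1 / real n" using n by (simp add: field_simps)
        finally show ?thesis .
      qed
    qed
    ultimately show ?case
      using prob_gap_ge[OF n less_imp_le[OF \<kappa>] T_def, of S] unfolding T_def h_def by auto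
  qed
  then show ?thesis using \<kappa> by blast
qed

end
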